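(* Fix a genus $g\ge0$. For $n,k\ge1$ let $r(n,k)$ be the number of reduced partitions of $\{1,\ldots,n\}$ of genus $g$ with $k$ parts. Then the generating function $R(x,y)=\sum_{n,k}r(n,k)x^ny^k$ is a rational function of $x$ and $y$. Moreover, the denominator of $R(x,y)$ is a power of $1-x^2y$.
   Context: For $n\ge1$ let $\zeta_n=(1,2,\ldots,n)$; $z(\cdot)$ is the number of cycles of a permutation (fixed points included); products are composed right to left. The genus $g(\alpha)$ of a permutation $\alpha$ of $\{1,\ldots,n\}$ is the nonnegative integer defined by $n+1-2g(\alpha)=z(\alpha)+z(\alpha^{-1}\zeta_n)$. A permutation is a partition if each of its cycles, listed beginning with its least element, is an increasing list; the parts are the cycles. A permutation $\alpha$ is reduced if neither $\alpha$ nor $\alpha^{-1}\zeta_n$ has a fixed point. "The denominator is a power of $1-x^2y$" means that $R(x,y)=A(x,y)/(1-x^2y)^N$ for some polynomial $A$ and some integer $N\ge0$. *)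

theory Defs
  imports
    "HOL-Combinatorics.Cycles"
    "HOL-Combinatorics.Orbits"
    "HOL-Computational_Algebra.Polynomial_FPS"
begin

text \<open>
  Permutations of \<open>{1..n}\<close> are functions \<open>\<alpha> :: nat \<Rightarrow> nat\<close> with \<open>\<alpha> permutes {1..n}\<close>;
  products are composed right to left, so they are compositions with \<open>\<circ>\<close>.
\<close>

definition zeta :: "nat \<Rightarrow> nat \<Rightarrow> nat" where
  "zeta n = cycle_of_list [1..<n + 1]"

text \<open>
  The cycles, represented by their underlying sets. Restricting to orbits of points of \<open>{1..n}\<close>
  keeps the fixed points inside \<open>{1..n}\<close> and discards those outside.
\<close>

definition cycle_sets :: "nat \<Rightarrow> (nat \<Rightarrow> nat) \<Rightarrow> nat set set" where
  "cycle_sets n \<alpha> = orbit \<alpha> ` {1..n}"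

definition num_cycles :: "nat \<Rightarrow> (nat \<Rightarrow> nat) \<Rightarrow> nat" where
  "num_cycles n \<alpha> = card (cycle_sets n \<alpha>)"

text \<open>
  The genus is determined by its defining equation, which is stated over the integers
  to avoid truncated subtraction.
\<close>

definition has_genus :: "nat \<Rightarrow> (nat \<Rightarrow> nat) \<Rightarrow> nat \<Rightarrow> bool" where
  "has_genus n \<alpha> g \<longleftrightarrow>
     int n + 1 - 2 * int g = int (num_cycles n \<alpha>) + int (num_cycles n (inv \<alpha> \<circ> zeta n))"

text \<open>
  \<open>support \<alpha> m\<close> is the list \<open>m, \<alpha> m, \<alpha> (\<alpha> m), \<dots>\<close> running once through the cycle of \<open>m\<close>.
\<close>

definition is_partition :: "nat \<Rightarrow> (nat \<Rightarrow> nat) \<Rightarrow> bool" where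
  "is_partition n \<alpha> \<longleftrightarrow> (\<forall>c \<in> cycle_sets n \<alpha>. sorted_wrt (<) (support \<alpha> (Min c)))"

definition is_reduced :: "nat \<Rightarrow> (nat \<Rightarrow> nat) \<Rightarrow> bool" where
  "is_reduced n \<alpha> \<longleftrightarrow> (\<forall>i \<in> {1..n}. \<alpha> i \<noteq> i \<and> (inv \<alpha> \<circ> zeta n) i \<noteq> i)"

definition reduced_partitions :: "nat \<Rightarrow> nat \<Rightarrow> nat \<Rightarrow> (nat \<Rightarrow> nat) set" where
  "reduced_partitions g n k =
     {\<alpha>. \<alpha> permutes {1..n} \<and> is_partition n \<alpha> \<and> is_reduced n \<alpha> \<and>
         has_genus n \<alpha> g \<and> num_cycles n \<alpha> = k}"

definition num_reduced :: "nat \<Rightarrow> nat \<Rightarrow> nat \<Rightarrow> nat" where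
  "num_reduced g n k = card (reduced_partitions g n k)"

text \<open>
  Bivariate series and polynomials in \<open>x, y\<close> are series (polynomials) in \<open>x\<close> whose coefficients
  are series (polynomials) in \<open>y\<close>.
\<close>

definition var_x :: "rat fps fps" where
  "var_x = fps_X"

definition var_y :: "rat fps fps" where
  "var_y = fps_const fps_X"

definition fps2_of_poly2 :: "rat poly poly \<Rightarrow> rat fps fps" where
  "fps2_of_poly2 A = fps_of_poly (map_poly fps_of_poly A)"

definition reduced_gf :: "nat \<Rightarrow> rat fps fps" where
  "reduced_gf g = Abs_fps (\<lambda>n. Abs_fps (\<lambda>k.
           if n \<ge> 1 \<and> k \<ge> 1 then of_nat (num_reduced g n k) else 0))"

text \<open>
  The coefficient ring \<^typ>\<open>rat fps\<close> is not a field, but powers of \<open>1 - x\<^sup>2 y\<close> are invertible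
  in \<^typ>\<open>rat fps fps\<close>, and division by them is the genuine quotient:
\<close>

lemma divide_power_denominator_iff:
  "F = G / (1 - var_x ^ 2 * var_y) ^ N \<longleftrightarrow> F * (1 - var_x ^ 2 * var_y) ^ N = G"
proof -
  define D where "D = (1 - var_x ^ 2 * var_y) ^ N"
  have D0: "fps_nth D 0 = 1"
    by (simp add: D_def var_x_def var_y_def fps_nth_power_0)
  then have sub: "subdegree D = 0"
    by (simp add: subdegree_eq_0_iff)
  have unit: "inverse D * D = 1"
    by (subst fps_inverse_def, rule fps_left_inverse'[where x = 1]) (simp_all add: D0)
  have "G / D = G * inverse D"
    by (simp add: fps_divide_def sub)
  moreover have "F = G * inverse D \<longleftrightarrow> F * D = G"
  proof
    assume "F = G * inverse D"
    then show "F * D = G"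
      by (simp only: mult.assoc unit mult_1_right)
  next
    assume "F * D = G"
    then have "G * inverse D = F * D * inverse D"
      by (simp only:)
    also have "\<dots> = F * (inverse D * D)"
      by (simp only: mult.assoc mult.commute[of D])
    finally show "F = G * inverse D"
      by (simp only: unit mult_1_right)
  qed
  ultimately show ?thesis
    unfolding D_def[symmetric] by simp
qed

end

theory Submission
  imports Defs
begin

text \<open>
  Write \<open>\<beta> = inv \<alpha> \<circ> \<zeta>\<^sub>n\<close>. If \<open>\<alpha>\<close> is reduced, all cycles of \<open>\<alpha>\<close> and \<open>\<beta>\<close> have length at least 2, and the
  excesses \<open>length - 2\<close> sum to \<open>4g - 2\<close>. Hence all but \<open>O(g)\<close> points lie in 2-cycles of both \<open>\<alpha>\<close> and
  \<open>\<beta>\<close>, which means that the 2-cycles of \<open>\<alpha>\<close> form \<open>O(g)\<close> ribbons of parallel chords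
  \<open>(p q), (p+1 q-1), \<dots>\<close>. Inserting a new chord just inside the first chord of a ribbon adds a 2-cycle
  to \<open>\<alpha>\<close> and one to \<open>\<beta>\<close>, and changes nothing else: it keeps the genus and multiplies the weight by
  \<open>x\<^sup>2y\<close>. So, among the \<open>\<alpha>\<close> with exactly \<open>L\<close> ribbons, multiplying by \<open>1 - x\<^sup>2y\<close> restricts one further
  ribbon to width 1. After \<open>L\<close> steps all ribbons have width 1, and only finitely many \<open>\<alpha>\<close> remain.
\<close>

section \<open>Adding a 2-cycle to a permutation\<close>

text \<open>\<open>emb a b\<close> is the increasing enumeration of the naturals other than \<open>a\<close> and \<open>b\<close>.\<close>

definition emb :: "nat \<Rightarrow> nat \<Rightarrow> nat \<Rightarrow> nat" where
  "emb a b x = (if x < a then x else if Suc x < b then Suc x else x + 2)"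

text \<open>The two maps are related by equations only, so that one development serves both
  \<open>\<alpha>\<close> and, with another pair of points,
  \<open>inv \<alpha> \<circ> zeta n\<close>.\<close>

locale chord_extension =
  fixes n a b :: nat and \<alpha> \<alpha>' :: "nat \<Rightarrow> nat"
  assumes a_pos: "1 \<le> a" and a_less_b: "a < b" and b_le: "b \<le> n + 2"
    and ext_emb: "\<alpha>' (emb a b x) = emb a b (\<alpha> x)"
    and ext_a: "\<alpha>' a = b" and ext_b: "\<alpha>' b = a"
begin

lemma emb_less_iff: "emb a b x < emb a b y \<longleftrightarrow> x < y"
  using a_less_b by (auto simp: emb_def)

lemma emb_eq_iff: "emb a b x = emb a b y \<longleftrightarrow> x = y"
  using emb_less_iff by (metis linorder_neq_iff)

lemma inj_emb: "inj_on (emb a b) A"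
  by (simp add: inj_on_def emb_eq_iff)

lemma emb_neq: "emb a b x \<noteq> a" "emb a b x \<noteq> b" "a \<noteq> emb a b x" "b \<noteq> emb a b x"
  using a_less_b by (auto simp: emb_def)

lemma emb_cases: obtains "y = a" | "y = b" | x where "y = emb a b x"
proof -
  \<comment> \<open>The inner conditional inverts \<open>emb a b\<close>: it subtracts the number of
    omitted points below \<open>y\<close>.\<close>
  have "y = emb a b (if y < a then y else if y < b then y - 1 else y - 2)" if "y \<noteq> a" "y \<noteq> b"
    using that a_less_b by (auto simp: emb_def)
  then show thesis
    using that by blast
qed

lemma emb_in_iff: "emb a b x \<in> {1..n + 2} \<longleftrightarrow> x \<in> {1..n}"
  using a_pos a_less_b b_le by (auto simp: emb_def)

lemma chord_in: "a \<in> {1..n + 2}" "b \<in> {1..n + 2}"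
  using a_pos a_less_b b_le by auto

lemma interval_ext: "{1..n + 2} = {a, b} \<union> emb a b ` {1..n}"
proof (rule set_eqI)
  fix y
  show "y \<in> {1..n + 2} \<longleftrightarrow> y \<in> {a, b} \<union> emb a b ` {1..n}"
    by (cases y rule: emb_cases)
      (simp_all only: chord_in emb_in_iff inj_image_mem_iff[OF inj_emb] Un_iff insert_iff empty_iff emb_neq simp_thms)
qed

lemma permutes_ext_iff: "\<alpha>' permutes {1..n + 2} \<longleftrightarrow> \<alpha> permutes {1..n}"
proof
  assume p: "\<alpha>' permutes {1..n + 2}"
  have "inj \<alpha>"
  proof (rule injI)
    fix x y assume "\<alpha> x = \<alpha> y"
    then have "\<alpha>' (emb a b x) = \<alpha>' (emb a b y)"
      by (simp add: ext_emb)
    then show "x = y"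
      using permutes_inj[OF p] by (simp add: inj_eq emb_eq_iff)
  qed
  moreover have "\<alpha> x \<in> {1..n}" if "x \<in> {1..n}" for x
    using that permutes_in_image[OF p, of "emb a b x"] by (simp only: ext_emb emb_in_iff)
  moreover have "\<alpha> x = x" if "x \<notin> {1..n}" for x
    using that permutes_not_in[OF p, of "emb a b x"] by (simp only: ext_emb emb_in_iff emb_eq_iff simp_thms)
  ultimately show "\<alpha> permutes {1..n}"
    by (rule inj_imp_permutes[OF inj_on_subset[OF _ subset_UNIV] finite_atLeastAtMost])
next
  assume p: "\<alpha> permutes {1..n}"
  have "x = y" if "\<alpha>' x = \<alpha>' y" for x y
    using that permutes_inj[OF p] emb_neq a_less_b
    by (cases x rule: emb_cases; cases y rule: emb_cases)
      (auto simp: ext_a ext_b ext_emb emb_eq_iff inj_eq)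
  then have "inj \<alpha>'"
    by (rule injI)
  moreover have "\<alpha>' x \<in> {1..n + 2}" if "x \<in> {1..n + 2}" for x
    using that
    by (cases x rule: emb_cases)
      (simp_all only: ext_a ext_b ext_emb chord_in emb_in_iff permutes_in_image[OF p])
  moreover have "\<alpha>' x = x" if "x \<notin> {1..n + 2}" for x
    using that
    by (cases x rule: emb_cases)
      (simp_all only: ext_emb chord_in emb_in_iff permutes_not_in[OF p] simp_thms)
  ultimately show "\<alpha>' permutes {1..n + 2}"
    by (rule inj_imp_permutes[OF inj_on_subset[OF _ subset_UNIV] finite_atLeastAtMost])
qed

lemma funpow_ext: "(\<alpha>' ^^ i) (emb a b x) = emb a b ((\<alpha> ^^ i) x)"
  by (induction i) (simp_all add: ext_emb)

lemma orbit_ext: "orbit \<alpha>' (emb a b x) = emb a b ` orbit \<alpha> x"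
  by (auto simp: orbit_altdef funpow_ext)

lemma orbit_ext_chord: "orbit \<alpha>' a = {a, b}" "orbit \<alpha>' b = {a, b}"
proof -
  have "y \<in> {a, b}" if "y \<in> orbit \<alpha>' a \<or> y \<in> orbit \<alpha>' b" for y
  proof -
    have "y \<in> {a, b}" if "y \<in> orbit \<alpha>' z" "z \<in> {a, b}" for z
      using that by induction (auto simp: ext_a ext_b)
    with that show ?thesis
      by blast
  qed
  moreover have "b \<in> orbit \<alpha>' a" "a \<in> orbit \<alpha>' b"
    by (metis ext_a ext_b orbit.base)+
  moreover from this have "a \<in> orbit \<alpha>' a" "b \<in> orbit \<alpha>' b"
    by (metis ext_a ext_b orbit.step)+
  ultimately show "orbit \<alpha>' a = {a, b}" "orbit \<alpha>' b = {a, b}"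
    by blast+
qed

lemma cycle_sets_ext:
  "cycle_sets (n + 2) \<alpha>' = insert {a, b} ((`) (emb a b) ` cycle_sets n \<alpha>)"
proof -
  have "cycle_sets (n + 2) \<alpha>' = {orbit \<alpha>' a, orbit \<alpha>' b} \<union> (\<lambda>x. orbit \<alpha>' (emb a b x)) ` {1..n}"
    unfolding cycle_sets_def interval_ext by auto
  then show ?thesis
    by (simp add: orbit_ext orbit_ext_chord cycle_sets_def image_image)
qed

lemma num_cycles_ext: "num_cycles (n + 2) \<alpha>' = Suc (num_cycles n \<alpha>)"
proof -
  have "{a, b} \<noteq> emb a b ` c" for c
    using emb_neq by blast
  then have "{a, b} \<notin> (`) (emb a b) ` cycle_sets n \<alpha>"
    by blast
  moreover have "inj_on ((`) (emb a b)) (cycle_sets n \<alpha>)"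
    by (rule inj_onI) (simp add: inj_image_eq_iff[OF inj_emb])
  ultimately show ?thesis
    unfolding num_cycles_def cycle_sets_ext
    by (simp add: card_image cycle_sets_def[of n])
qed

lemma fixpoint_free_ext_iff:
  "(\<forall>i\<in>{1..n + 2}. \<alpha>' i \<noteq> i) \<longleftrightarrow> (\<forall>i\<in>{1..n}. \<alpha> i \<noteq> i)"
  unfolding interval_ext using a_less_b
  by (auto simp: ext_a ext_b ext_emb emb_eq_iff simp del: atLeastAtMost_iff)

lemma support_ext: "support \<alpha>' (emb a b x) = map (emb a b) (support \<alpha> x)"
  by (simp add: least_power_def funpow_ext emb_eq_iff)

lemma support_ext_chord: "support \<alpha>' a = [a, b]"
proof -
  have "least_power \<alpha>' a = 2"
    unfolding least_power_def
  proof (rule Least_equality)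
    fix i assume "(\<alpha>' ^^ i) a = a \<and> 0 < i"
    moreover have "i \<noteq> 1"
      using calculation a_less_b by (auto simp: ext_a)
    ultimately show "2 \<le> i"
      by linarith
  qed (simp add: numeral_2_eq_2 ext_a ext_b)
  then show ?thesis
    by (simp add: upt_conv_Cons ext_a numeral_2_eq_2)
qed

text \<open>Since \<open>emb a b\<close> is strictly increasing, it commutes with \<open>Min\<close>
  on the finite cycles and preserves the order of the listed points; the new cycle is listed as
  \<open>[a, b]\<close>.\<close>

lemma is_partition_ext_iff:
  assumes "\<alpha> permutes {1..n}"
  shows "is_partition (n + 2) \<alpha>' \<longleftrightarrow> is_partition n \<alpha>"
proof -
  have "Min (emb a b ` c) = emb a b (Min c)" if "c \<in> cycle_sets n \<alpha>" for c
  proof -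
    obtain x where x: "x \<in> {1..n}" "c = orbit \<alpha> x"
      using \<open>c \<in> cycle_sets n \<alpha>\<close> unfolding cycle_sets_def by blast
    have "finite c"
      unfolding x(2) using permutes_orbit_subset[OF assms x(1)] by (rule finite_subset) simp
    moreover have "c \<noteq> {}"
      unfolding x(2) by (rule orbit_nonempty)
    moreover have "mono (emb a b)"
      by (rule monoI) (metis emb_less_iff linorder_not_le)
    ultimately show ?thesis
      by (simp add: mono_Min_commute)
  qed
  then have "sorted_wrt (<) (support \<alpha>' (Min (emb a b ` c))) \<longleftrightarrow> sorted_wrt (<) (support \<alpha> (Min c))"
    if "c \<in> cycle_sets n \<alpha>" for c
    using that by (simp only: support_ext) (simp add: sorted_wrt_map emb_less_iff)
  moreover have "Min {a, b} = a"
    using a_less_b by simp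
  then have "sorted_wrt (<) (support \<alpha>' (Min {a, b}))"
    by (simp only: support_ext_chord) (simp add: a_less_b)
  ultimately show ?thesis
    unfolding is_partition_def cycle_sets_ext by (simp only: ball_simps simp_thms cong: ball_cong)
qed

end

text \<open>The explicit solution of the equations of \<open>chord_extension\<close>; the inner
  conditional undoes \<open>emb a b\<close>.\<close>

definition ins :: "nat \<Rightarrow> nat \<Rightarrow> (nat \<Rightarrow> nat) \<Rightarrow> nat \<Rightarrow> nat" where
  "ins a b \<alpha> y = (if y = a then b else if y = b then a else
     emb a b (\<alpha> (if y < a then y else if y < b then y - 1 else y - 2)))"

lemma chord_extension_ins:
  assumes "1 \<le> a" "a < b" "b \<le> n + 2"
  shows "chord_extension n a b \<alpha> (ins a b \<alpha>)"
proof
  show "ins a b \<alpha> (emb a b x) = emb a b (\<alpha> x)" for x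
    using assms by (auto simp: ins_def emb_def)
qed (use assms in \<open>auto simp: ins_def\<close>)

lemma (in chord_extension) ext_eq_ins: "\<alpha>' = ins a b \<alpha>"
proof
  fix y
  interpret i: chord_extension n a b \<alpha> "ins a b \<alpha>"
    using a_pos a_less_b b_le by (rule chord_extension_ins)
  show "\<alpha>' y = ins a b \<alpha> y"
    by (cases y rule: emb_cases) (simp_all add: ext_a ext_b ext_emb i.ext_a i.ext_b i.ext_emb)
qed

section \<open>Pointwise action of the long cycle\<close>

lemma zeta_apply: "zeta n x = (if x = 0 \<or> n < x then x else if x = n then 1 else Suc x)"
proof (cases "x = 0 \<or> n < x")
  case True
  then show ?thesis
    by (auto simp: zeta_def intro!: id_outside_supp)
next
  case False
  then obtain i where i: "x = Suc i" "i < n"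
    by (cases x) auto
  have "map (zeta n) [1..<n + 1] = rotate1 [1..<n + 1]"
    using cyclic_rotation[of "[1..<n + 1]" 1] by (simp add: zeta_def)
  then have "map (zeta n) [1..<n + 1] ! i = rotate1 [1..<n + 1] ! i"
    by simp
  then have "zeta n x = Suc (Suc i mod n)"
    using i by (simp add: nth_rotate1 del: upt_Suc)
  then show ?thesis
    using i by (cases "Suc i = n") auto
qed

lemma zeta_permutes: "zeta n permutes {1..n}"
  using cycle_permutes[of "[1..<n + 1]"] by (simp add: zeta_def atLeastLessThanSuc_atLeastAtMost del: upt_Suc)

section \<open>Ribbons of parallel chords\<close>

definition opens :: "(nat \<Rightarrow> nat) \<Rightarrow> nat \<Rightarrow> bool" where
  "opens \<alpha> p \<longleftrightarrow> p < \<alpha> p \<and> \<alpha> (\<alpha> p) = p"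

text \<open>The chord at \<open>Suc p\<close> lies directly inside the chord at \<open>p\<close>;
  the last equation says that its right endpoint is \<open>\<alpha> p - 1\<close>. If
  \<open>\<alpha>\<close> permutes \<open>{1..n}\<close>, the map
  \<open>inv \<alpha> \<circ> zeta n\<close> then exchanges \<open>p\<close> and
  \<open>\<alpha> p - 1\<close>.\<close>

definition nested :: "(nat \<Rightarrow> nat) \<Rightarrow> nat \<Rightarrow> bool" where
  "nested \<alpha> p \<longleftrightarrow> opens \<alpha> p \<and> opens \<alpha> (Suc p) \<and> \<alpha> p = Suc (\<alpha> (Suc p))"

text \<open>A ribbon is represented by the left endpoint of its outermost chord.\<close>

definition ribbons :: "(nat \<Rightarrow> nat) \<Rightarrow> nat set" where
  "ribbons \<alpha> = {p. opens \<alpha> p \<and> (\<forall>x. p = Suc x \<longrightarrow> \<not> nested \<alpha> x)}"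

text \<open>A new chord is put directly inside the chord \<open>(p q)\<close>: in
  \<open>\<alpha>'\<close> the old chord joins \<open>p\<close> to \<open>q + 2\<close>, and the new
  one joins \<open>p + 1\<close> to \<open>q + 1\<close>.\<close>

locale parallel_chord =
  fixes n p q :: nat and \<alpha> \<alpha>' :: "nat \<Rightarrow> nat"
  assumes perm: "\<alpha> permutes {1..n}"
    and chord: "p < q" "\<alpha> p = q" "\<alpha> q = p"
    and extension: "chord_extension n (p + 1) (q + 1) \<alpha> \<alpha>'"
begin

sublocale ext: chord_extension n "p + 1" "q + 1" \<alpha> \<alpha>'
  by (rule extension)

lemma perm': "\<alpha>' permutes {1..n + 2}"
  by (simp only: ext.permutes_ext_iff perm)

lemma chord_range: "1 \<le> p" "q \<le> n"
  using permutes_not_in[OF perm, of p] permutes_not_in[OF perm, of q] chord by fastforce+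

text \<open>In \<open>\<beta>\<close> the new chord joins \<open>p\<close> to \<open>q + 1\<close>, so the old points are relabelled differently.\<close>

sublocale dual: chord_extension n p "q + 1" "inv \<alpha> \<circ> zeta n" "inv \<alpha>' \<circ> zeta (n + 2)"
proof
  note inv_eq = permutes_inv_eq[OF perm']
  fix x
  define y where "y = inv \<alpha> (zeta n x)"
  have y: "\<alpha> y = zeta n x"
    unfolding y_def by (rule permutes_inverses(1)[OF perm])
  \<comment> \<open>The relabellings \<open>emb p (q + 1)\<close> and
    \<open>emb (p + 1) (q + 1)\<close> differ only at \<open>p\<close>, so \<open>y = p\<close> is
    the exceptional case.\<close>
  have "\<alpha>' (emb p (q + 1) y) = zeta (n + 2) (emb p (q + 1) x)"
  proof (cases "y = p")
    case True
    then have "Suc x = q"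
      using y chord chord_range by (auto simp: zeta_apply split: if_splits)
    then show ?thesis
      using True chord chord_range ext.ext_a by (auto simp: emb_def zeta_apply)
  next
    case False
    then have "emb p (q + 1) y = emb (p + 1) (q + 1) y"
      by (auto simp: emb_def)
    \<comment> \<open>Relabelling is compatible with the long cycle except at
      \<open>x = q - 1\<close>, where the new point \<open>q + 1\<close> comes between the images of
      \<open>q - 1\<close> and \<open>q\<close>.\<close>
    moreover have "zeta n x \<noteq> q"
      using False y chord permutes_inj[OF perm] by (metis injD)
    then have "emb (p + 1) (q + 1) (zeta n x) = zeta (n + 2) (emb p (q + 1) x)"
      using chord chord_range by (auto simp: emb_def zeta_apply split: if_splits)
    ultimately show ?thesis
      by (simp only: ext.ext_emb y)
  qed
  then show "(inv \<alpha>' \<circ> zeta (n + 2)) (emb p (q + 1) x) = emb p (q + 1) ((inv \<alpha> \<circ> zeta n) x)"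
    by (simp add: inv_eq flip: y_def)
next
  note inv_eq = permutes_inv_eq[OF perm']
  have "\<alpha>' (q + 1) = p + 1"
    by (rule ext.ext_b)
  then show "(inv \<alpha>' \<circ> zeta (n + 2)) p = q + 1"
    using chord chord_range by (simp add: inv_eq zeta_apply)
  have "emb (p + 1) (q + 1) q = q + 2" "emb (p + 1) (q + 1) p = p"
    using chord by (auto simp: emb_def)
  then have "\<alpha>' p = q + 2"
    using ext.ext_emb[of p] chord by simp
  then show "(inv \<alpha>' \<circ> zeta (n + 2)) (q + 1) = p"
    using chord chord_range by (simp add: inv_eq zeta_apply)
qed (use chord chord_range in auto)

text \<open>Both \<open>\<alpha>\<close> and \<open>inv \<alpha> \<circ> zeta n\<close> gain one
  2-cycle while \<open>n\<close> grows by 2, so the genus equation gains 2 on either side. Neither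
  map gains or loses a fixed point among the points considered.\<close>

lemma reduced_partitions_ext_iff:
  "\<alpha>' \<in> reduced_partitions g (n + 2) (k + 1) \<longleftrightarrow> \<alpha> \<in> reduced_partitions g n k"
proof -
  have "is_reduced (n + 2) \<alpha>' \<longleftrightarrow> is_reduced n \<alpha>"
    using ext.fixpoint_free_ext_iff dual.fixpoint_free_ext_iff
    unfolding is_reduced_def ball_conj_distrib by blast
  moreover have "has_genus (n + 2) \<alpha>' g \<longleftrightarrow> has_genus n \<alpha> g"
    unfolding has_genus_def ext.num_cycles_ext dual.num_cycles_ext by auto
  ultimately show ?thesis
    unfolding reduced_partitions_def mem_Collect_eq ext.num_cycles_ext
      ext.permutes_ext_iff ext.is_partition_ext_iff[OF perm] by simp
qed

lemma opens_ext: "opens \<alpha>' (emb (p + 1) (q + 1) x) \<longleftrightarrow> opens \<alpha> x"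
  by (simp only: opens_def ext.ext_emb ext.emb_less_iff ext.emb_eq_iff)

lemma opens_ext_chord: "opens \<alpha>' (p + 1)" "\<not> opens \<alpha>' (q + 1)"
  using chord by (simp_all only: opens_def ext.ext_a ext.ext_b) simp_all

lemma not_opens_right: "\<not> opens \<alpha> q"
  using chord by (simp add: opens_def)

lemma ext_p: "\<alpha>' p = q + 2" and emb_p: "emb (p + 1) (q + 1) p = p"
proof -
  show *: "emb (p + 1) (q + 1) p = p"
    using chord by (auto simp: emb_def)
  have "emb (p + 1) (q + 1) q = q + 2"
    using chord by (auto simp: emb_def)
  with * show "\<alpha>' p = q + 2"
    using ext.ext_emb[of p] chord by simp
qed

lemma nested_ext_p: "nested \<alpha>' p"
proof -
  have "opens \<alpha> p"
    using chord by (simp add: opens_def)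
  then have "opens \<alpha>' p"
    using opens_ext[of p] by (simp only: emb_p)
  then show ?thesis
    using opens_ext_chord(1) ext_p ext.ext_a by (simp add: nested_def)
qed

text \<open>Nesting compares neighbouring points, and the insertion separates only \<open>p\<close>
  from \<open>p + 1\<close> and \<open>q - 1\<close> from \<open>q\<close>. The first gap is
  excluded by \<open>x \<noteq> p\<close>; in the second, \<open>q\<close> is a right endpoint, so
  nothing is nested there before or after.\<close>

lemma nested_ext_iff:
  assumes "x \<noteq> p"
  shows "nested \<alpha>' (emb (p + 1) (q + 1) x) \<longleftrightarrow> nested \<alpha> x"
proof (cases "x = q \<or> Suc x = q")
  case True
  then have "\<not> nested \<alpha> x"
    using not_opens_right by (auto simp: nested_def)
  moreover have "\<not> nested \<alpha>' (emb (p + 1) (q + 1) x)"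
  proof (cases "x = q")
    case True
    then show ?thesis
      using opens_ext[of q] not_opens_right by (simp add: nested_def)
  next
    case False
    then have "Suc (emb (p + 1) (q + 1) x) = q + 1"
      using True assms chord by (auto simp: emb_def)
    then show ?thesis
      using opens_ext_chord(2) by (simp add: nested_def)
  qed
  ultimately show ?thesis
    by simp
next
  case False
  have emb_Suc: "emb (p + 1) (q + 1) u = Suc (emb (p + 1) (q + 1) v) \<longleftrightarrow> u = Suc v"
    if "v \<noteq> p" "u \<noteq> q" for u v
    using that chord(1) by (auto simp: emb_def)
  have "Suc (emb (p + 1) (q + 1) x) = emb (p + 1) (q + 1) (Suc x)"
    using False assms emb_Suc[of x "Suc x"] by simp
  then have "nested \<alpha>' (emb (p + 1) (q + 1) x) \<longleftrightarrow> opens \<alpha> x \<and> opens \<alpha> (Suc x) \<and>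
      emb (p + 1) (q + 1) (\<alpha> x) = Suc (emb (p + 1) (q + 1) (\<alpha> (Suc x)))"
    by (simp only: nested_def opens_ext ext.ext_emb)
  moreover have "\<alpha> x \<noteq> q" if "opens \<alpha> x"
    using that assms chord by (auto simp: opens_def)
  moreover have "\<alpha> (Suc x) \<noteq> p" if "opens \<alpha> (Suc x)"
    using that False chord by (auto simp: opens_def)
  ultimately show ?thesis
    using emb_Suc by (auto simp: nested_def)
qed

text \<open>The new chord joins the ribbon of \<open>p\<close> without being outermost, and a chord
  that was directly inside \<open>(p q)\<close> is now directly inside the new chord. Hence the
  outermost chords are the relabelled old ones.\<close>

lemma ribbons_ext: "ribbons \<alpha>' = emb (p + 1) (q + 1) ` ribbons \<alpha>"
proof (rule set_eqI)
  fix y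
  have mem_iff: "emb (p + 1) (q + 1) x \<in> ribbons \<alpha>' \<longleftrightarrow> x \<in> ribbons \<alpha>" for x
  proof (cases "opens \<alpha> x")
    case True
    have "(\<exists>z. emb (p + 1) (q + 1) x = Suc z \<and> nested \<alpha>' z) \<longleftrightarrow> (\<exists>z. x = Suc z \<and> nested \<alpha> z)"
    proof (cases x)
      case 0
      then show ?thesis
        by (simp add: emb_def)
    next
      case (Suc z)
      have "x \<noteq> q"
        using True not_opens_right by auto
      show ?thesis
      proof (cases "z = p")
        case False
        then have "emb (p + 1) (q + 1) x = Suc (emb (p + 1) (q + 1) z)"
          using Suc \<open>x \<noteq> q\<close> chord(1) by (auto simp: emb_def)
        then show ?thesis
          using nested_ext_iff[OF False] Suc by auto
      next
        case z: True
        have emb_x: "emb (p + 1) (q + 1) x = Suc (p + 1)"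
          using z Suc \<open>x \<noteq> q\<close> chord(1) by (auto simp: emb_def)
        \<comment> \<open>Here the new chord takes over the role of \<open>(p q)\<close> as the
          possible outer neighbour of the chord at \<open>x = p + 1\<close>.\<close>
        have "nested \<alpha>' (p + 1) \<longleftrightarrow> opens \<alpha>' (emb (p + 1) (q + 1) x) \<and>
            q + 1 = Suc (\<alpha>' (emb (p + 1) (q + 1) x))"
          using opens_ext_chord(1) ext.ext_a by (simp only: nested_def emb_x simp_thms)
        also have "\<dots> \<longleftrightarrow> q = emb (p + 1) (q + 1) (\<alpha> x)"
          by (simp add: opens_ext[unfolded Suc_eq_plus1[symmetric]] True
              ext.ext_emb[unfolded Suc_eq_plus1[symmetric]])
        also have "\<dots> \<longleftrightarrow> q = Suc (\<alpha> x)"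
          using z Suc True \<open>x \<noteq> q\<close> chord(1) by (auto simp: emb_def opens_def)
        also have "\<dots> \<longleftrightarrow> nested \<alpha> p"
          using chord True z Suc by (auto simp: nested_def opens_def)
        finally show ?thesis
          using emb_x z Suc by auto
      qed
    qed
    then show ?thesis
      unfolding ribbons_def mem_Collect_eq opens_ext by blast
  next
    case False
    then show ?thesis
      by (simp only: ribbons_def mem_Collect_eq opens_ext simp_thms)
  qed
  have "p + 1 \<notin> ribbons \<alpha>'"
    using nested_ext_p by (simp add: ribbons_def)
  moreover have "q + 1 \<notin> ribbons \<alpha>'"
    using opens_ext_chord(2) by (simp add: ribbons_def)
  moreover have "p + 1 \<notin> emb (p + 1) (q + 1) ` ribbons \<alpha>" "q + 1 \<notin> emb (p + 1) (q + 1) ` ribbons \<alpha>"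
    using ext.emb_neq by blast+
  ultimately show "y \<in> ribbons \<alpha>' \<longleftrightarrow> y \<in> emb (p + 1) (q + 1) ` ribbons \<alpha>"
    by (cases y rule: ext.emb_cases)
      (simp_all only: mem_iff inj_image_mem_iff[OF ext.inj_emb] simp_thms)
qed

end

section \<open>Ribbons ranked from the left\<close>

lemma ex1_rank:
  fixes P :: "nat set"
  assumes "finite P" "j < card P"
  shows "\<exists>!p. p \<in> P \<and> card (P \<inter> {..<p}) = j"
proof -
  \<comment> \<open>Ranks increase strictly along \<open>P\<close> and stay below
    \<open>card P\<close>, so each value below \<open>card P\<close> is taken exactly once.\<close>
  have less: "card (P \<inter> {..<x}) < card (P \<inter> {..<y})" if "x \<in> P" "x < y" for x y
    using that assms by (intro psubset_card_mono) auto
  then have inj: "inj_on (\<lambda>p. card (P \<inter> {..<p})) P"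
    by (intro linorder_inj_onI) (auto simp: nat_neq_iff)
  have "card (P \<inter> {..<p}) < card P" if "p \<in> P" for p
    using that assms by (intro psubset_card_mono) auto
  then have "(\<lambda>p. card (P \<inter> {..<p})) ` P \<subseteq> {..<card P}"
    by auto
  then have "(\<lambda>p. card (P \<inter> {..<p})) ` P = {..<card P}"
    by (intro card_subset_eq) (simp_all add: card_image[OF inj])
  then have "j \<in> (\<lambda>p. card (P \<inter> {..<p})) ` P"
    using assms by simp
  then show ?thesis
    using inj by (auto dest: inj_onD)
qed

lemma opens_in_interval:
  assumes "\<alpha> permutes {1..n}" "opens \<alpha> p"
  shows "1 \<le> p" "p < \<alpha> p" "\<alpha> p \<le> n"
proof -
  have "p \<in> {1..n}"
    using permutes_not_in[OF assms(1), of p] assms(2)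
    by (auto simp: opens_def simp del: atLeastAtMost_iff)
  moreover from this have "\<alpha> p \<in> {1..n}"
    by (simp only: permutes_in_image[OF assms(1)])
  ultimately show "1 \<le> p" "\<alpha> p \<le> n"
    by auto
qed (use assms in \<open>simp add: opens_def\<close>)

lemma finite_ribbons: "\<alpha> permutes {1..n} \<Longrightarrow> finite (ribbons \<alpha>)"
proof (rule finite_subset[of _ "{1..n}"])
  assume "\<alpha> permutes {1..n}"
  then have "x \<in> {1..n}" if "opens \<alpha> x" for x
    using that opens_in_interval[of \<alpha> n x] by simp
  then show "ribbons \<alpha> \<subseteq> {1..n}"
    unfolding ribbons_def by blast
qed simp

lemma finite_reduced_partitions: "finite (reduced_partitions g n k)"
  by (rule finite_subset[OF _ finite_permutations[of "{1..n}"]]) (auto simp: reduced_partitions_def)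

text \<open>The first \<open>j\<close> of the \<open>L\<close> ribbons, counted from the left, are required to have width 1.\<close>

definition narrow :: "nat \<Rightarrow> nat \<Rightarrow> nat \<Rightarrow> nat \<Rightarrow> nat \<Rightarrow> (nat \<Rightarrow> nat) set" where
  "narrow g L j n k = {\<alpha> \<in> reduced_partitions g n k. card (ribbons \<alpha>) = L \<and>
     (\<forall>x\<in>ribbons \<alpha>. card (ribbons \<alpha> \<inter> {..<x}) < j \<longrightarrow> \<not> nested \<alpha> x)}"

lemma finite_narrow: "finite (narrow g L j n k)"
  using finite_reduced_partitions by (simp add: narrow_def)

lemma permutes_narrow: "\<alpha> \<in> narrow g L j n k \<Longrightarrow> \<alpha> permutes {1..n}"
  by (simp add: narrow_def reduced_partitions_def)

context parallel_chord
begin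

lemma rank_ext:
  "card (ribbons \<alpha>' \<inter> {..<emb (p + 1) (q + 1) x}) = card (ribbons \<alpha> \<inter> {..<x})"
proof -
  have "ribbons \<alpha>' \<inter> {..<emb (p + 1) (q + 1) x} = emb (p + 1) (q + 1) ` (ribbons \<alpha> \<inter> {..<x})"
    unfolding ribbons_ext using ext.emb_less_iff by blast
  then show ?thesis
    by (simp only: card_image[OF ext.inj_emb])
qed

lemma p_in_ribbons_iff: "p \<in> ribbons \<alpha>' \<longleftrightarrow> p \<in> ribbons \<alpha>"
  using inj_image_mem_iff[OF ext.inj_emb, of p "ribbons \<alpha>"]
  unfolding ribbons_ext by (simp only: emb_p)

lemma rank_p: "card (ribbons \<alpha>' \<inter> {..<p}) = card (ribbons \<alpha> \<inter> {..<p})"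
  using rank_ext[of p] by (simp only: emb_p)

text \<open>For old chords the insertion can change nesting only at \<open>p\<close>. Its rank is
  \<open>j\<close>, and \<open>narrow\<close> restricts only ribbons of rank less than
  \<open>j\<close>.\<close>

lemma narrow_ext_iff:
  assumes "card (ribbons \<alpha> \<inter> {..<p}) = j"
  shows "\<alpha>' \<in> narrow g L j (n + 2) (k + 1) \<longleftrightarrow> \<alpha> \<in> narrow g L j n k"
proof -
  have "card (ribbons \<alpha>') = card (ribbons \<alpha>)"
    unfolding ribbons_ext by (rule card_image[OF ext.inj_emb])
  moreover have "(\<forall>x\<in>ribbons \<alpha>'. card (ribbons \<alpha>' \<inter> {..<x}) < j \<longrightarrow> \<not> nested \<alpha>' x) \<longleftrightarrow>
      (\<forall>x\<in>ribbons \<alpha>. card (ribbons \<alpha> \<inter> {..<x}) < j \<longrightarrow> \<not> nested \<alpha>' (emb (p + 1) (q + 1) x))"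
    by (subst (1) ribbons_ext) (simp only: ball_simps rank_ext)
  moreover have "\<dots> \<longleftrightarrow> (\<forall>x\<in>ribbons \<alpha>. card (ribbons \<alpha> \<inter> {..<x}) < j \<longrightarrow> \<not> nested \<alpha> x)"
  proof (intro ball_cong refl)
    fix x
    show "(card (ribbons \<alpha> \<inter> {..<x}) < j \<longrightarrow> \<not> nested \<alpha>' (emb (p + 1) (q + 1) x)) \<longleftrightarrow>
        (card (ribbons \<alpha> \<inter> {..<x}) < j \<longrightarrow> \<not> nested \<alpha> x)"
      by (cases "x = p") (simp_all only: assms less_irrefl nested_ext_iff simp_thms)
  qed
  ultimately show ?thesis
    unfolding narrow_def mem_Collect_eq reduced_partitions_ext_iff by simp
qed

end

section \<open>Widening a ribbon as a bijection\<close>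

lemma parallel_chord_ins:
  assumes "\<alpha> permutes {1..n}" "opens \<alpha> p"
  shows "parallel_chord n p (\<alpha> p) \<alpha> (ins (p + 1) (\<alpha> p + 1) \<alpha>)"
  using assms opens_in_interval[OF assms]
  by (intro parallel_chord.intro chord_extension_ins) (auto simp: opens_def)

text \<open>The converse of insertion: the chord directly inside the one at \<open>p\<close> is
  removed.\<close>

lemma parallel_chord_exists:
  assumes perm: "\<alpha>' permutes {1..n + 2}" and nested: "nested \<alpha>' p"
  shows "\<exists>q \<alpha>. parallel_chord n p q \<alpha> \<alpha>'"
proof -
  \<comment> \<open>The chord to remove must be \<open>(p+1 q+1)\<close>, which determines
    \<open>q\<close>; \<open>d\<close> inverts the relabelling away from its two endpoints.\<close>
  define q where "q = \<alpha>' (p + 1) - 1"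
  define d where "d y = (if y < p + 1 then y else if y < q + 1 then y - 1 else y - 2)" for y
  have p: "opens \<alpha>' p" "opens \<alpha>' (p + 1)" "\<alpha>' p = Suc (\<alpha>' (p + 1))"
    using nested by (simp_all add: nested_def)
  then have q: "p < q" "\<alpha>' (p + 1) = q + 1" "\<alpha>' (q + 1) = p + 1" "\<alpha>' p = q + 2" "\<alpha>' (q + 2) = p"
    by (auto simp: opens_def q_def)
  have "q \<le> n"
    using opens_in_interval[OF perm p(1)] q by simp
  have emb_d: "emb (p + 1) (q + 1) (d y) = y" if "y \<noteq> p + 1" "y \<noteq> q + 1" for y
    using that q(1) by (auto simp: emb_def d_def)
  define \<alpha> where "\<alpha> x = d (\<alpha>' (emb (p + 1) (q + 1) x))" for x
  interpret chord_extension n "p + 1" "q + 1" \<alpha> \<alpha>'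
  proof
    fix x
    have "\<alpha>' (emb (p + 1) (q + 1) x) \<noteq> p + 1" "\<alpha>' (emb (p + 1) (q + 1) x) \<noteq> q + 1"
      using q(1) injD[OF permutes_inj[OF perm], of "emb (p + 1) (q + 1) x" "p + 1"]
        injD[OF permutes_inj[OF perm], of "emb (p + 1) (q + 1) x" "q + 1"]
      by (auto simp: q(2,3)[simplified] emb_def split: if_splits)
    then show "\<alpha>' (emb (p + 1) (q + 1) x) = emb (p + 1) (q + 1) (\<alpha> x)"
      unfolding \<alpha>_def by (rule emb_d[symmetric])
  qed (use q \<open>q \<le> n\<close> in auto)
  have "\<alpha> p = q" "\<alpha> q = p"
    using q by (auto simp: \<alpha>_def emb_def d_def)
  moreover have "\<alpha> permutes {1..n}"
    using perm by (simp only: permutes_ext_iff)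
  ultimately have "parallel_chord n p q \<alpha> \<alpha>'"
    using q(1) chord_extension_axioms by unfold_locales auto
  then show ?thesis
    by blast
qed

text \<open>The elements lost in passing from \<open>j\<close> to \<open>Suc j\<close> are those
  whose ribbon of rank \<open>j\<close> has width at least 2. They arise uniquely by widening that
  ribbon in an element for \<open>n\<close> and \<open>k\<close>; \<open>j < L\<close> guarantees
  that the ribbon exists.\<close>

lemma card_narrow_Suc:
  assumes "j < L"
  shows "card (narrow g L j (n + 2) (k + 1)) =
    card (narrow g L (Suc j) (n + 2) (k + 1)) + card (narrow g L j n k)"
proof -
  define start where
    "start \<alpha> = (THE p. p \<in> ribbons \<alpha> \<and> card (ribbons \<alpha> \<inter> {..<p}) = j)" for \<alpha>
  define E where "E \<alpha> = ins (start \<alpha> + 1) (\<alpha> (start \<alpha>) + 1) \<alpha>" for \<alpha>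
  have ex1: "\<exists>!p. p \<in> ribbons \<alpha> \<and> card (ribbons \<alpha> \<inter> {..<p}) = j" if "\<alpha> \<in> narrow g L j n k" for \<alpha> n k
    using that assms finite_ribbons[OF permutes_narrow[OF that]]
    by (intro ex1_rank) (simp_all add: narrow_def)
  have start: "start \<alpha> \<in> ribbons \<alpha>" "card (ribbons \<alpha> \<inter> {..<start \<alpha>}) = j"
    if "\<alpha> \<in> narrow g L j n k" for \<alpha> n k
    using theI'[OF ex1[OF that]] by (simp_all add: start_def)
  have start_eq: "start \<alpha> = p"
    if "\<alpha> \<in> narrow g L j n k" "p \<in> ribbons \<alpha>" "card (ribbons \<alpha> \<inter> {..<p}) = j" for \<alpha> p n k
    unfolding start_def using that by (intro the1_equality[OF ex1]) auto
  have par: "parallel_chord n (start \<alpha>) (\<alpha> (start \<alpha>)) \<alpha> (E \<alpha>)" if "\<alpha> \<in> narrow g L j n k" for \<alpha>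
    unfolding E_def using start(1)[OF that] permutes_narrow[OF that]
    by (intro parallel_chord_ins) (auto simp: ribbons_def)
  have E_narrow: "E \<alpha> \<in> narrow g L j (n + 2) (k + 1)" "start (E \<alpha>) = start \<alpha>" "nested (E \<alpha>) (start \<alpha>)"
    if \<alpha>: "\<alpha> \<in> narrow g L j n k" for \<alpha>
  proof -
    interpret parallel_chord n "start \<alpha>" "\<alpha> (start \<alpha>)" \<alpha> "E \<alpha>"
      by (rule par[OF \<alpha>])
    show *: "E \<alpha> \<in> narrow g L j (n + 2) (k + 1)"
      using narrow_ext_iff[OF start(2)[OF \<alpha>]] \<alpha> by blast
    show "start (E \<alpha>) = start \<alpha>"
      using start[OF \<alpha>] by (intro start_eq[OF *]) (simp_all only: p_in_ribbons_iff rank_p)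
    show "nested (E \<alpha>) (start \<alpha>)"
      by (rule nested_ext_p)
  qed
  have inj: "inj_on E (narrow g L j n k)"
  proof (rule inj_onI)
    fix \<alpha> \<beta> assume \<alpha>: "\<alpha> \<in> narrow g L j n k" and \<beta>: "\<beta> \<in> narrow g L j n k" and eq: "E \<alpha> = E \<beta>"
    interpret A: parallel_chord n "start \<alpha>" "\<alpha> (start \<alpha>)" \<alpha> "E \<alpha>"
      by (rule par[OF \<alpha>])
    interpret B: parallel_chord n "start \<beta>" "\<beta> (start \<beta>)" \<beta> "E \<beta>"
      by (rule par[OF \<beta>])
    have p: "start \<alpha> = start \<beta>"
      using E_narrow(2)[OF \<alpha>] E_narrow(2)[OF \<beta>] eq by simp
    \<comment> \<open>The widened map sends the common starting point to the old right endpoint plus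
      2, so that endpoint can be recovered.\<close>
    have q: "\<alpha> (start \<beta>) = \<beta> (start \<beta>)"
      using A.ext_p B.ext_p eq p by simp
    show "\<alpha> = \<beta>"
    proof
      fix x
      show "\<alpha> x = \<beta> x"
        using A.ext.ext_emb[of x] B.ext.ext_emb[of x] by (simp only: p q eq B.ext.emb_eq_iff)
    qed
  qed
  have "narrow g L j (n + 2) (k + 1) - narrow g L (Suc j) (n + 2) (k + 1) = E ` narrow g L j n k"
  proof (intro set_eqI iffI)
    fix \<alpha>' assume \<alpha>': "\<alpha>' \<in> narrow g L j (n + 2) (k + 1) - narrow g L (Suc j) (n + 2) (k + 1)"
    \<comment> \<open>A ribbon violating the condition for \<open>Suc j\<close> but not the one for
      \<open>j\<close> must have rank exactly \<open>j\<close>.\<close>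
    then obtain p where p: "p \<in> ribbons \<alpha>'" "card (ribbons \<alpha>' \<inter> {..<p}) = j" "nested \<alpha>' p"
      by (auto simp: narrow_def less_Suc_eq)
    obtain q \<alpha> where "parallel_chord n p q \<alpha> \<alpha>'"
      using \<alpha>' p(3) parallel_chord_exists permutes_narrow by blast
    then interpret parallel_chord n p q \<alpha> \<alpha>' .
    have p': "p \<in> ribbons \<alpha>" "card (ribbons \<alpha> \<inter> {..<p}) = j"
      using p by (simp_all only: p_in_ribbons_iff rank_p)
    then have \<alpha>: "\<alpha> \<in> narrow g L j n k"
      using \<alpha>' narrow_ext_iff by blast
    then have "E \<alpha> = \<alpha>'"
      using start_eq[OF \<alpha> p'] chord(2) ext.ext_eq_ins by (simp add: E_def)
    then show "\<alpha>' \<in> E ` narrow g L j n k"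
      using \<alpha> by blast
  next
    fix \<alpha>' assume "\<alpha>' \<in> E ` narrow g L j n k"
    then obtain \<alpha> where \<alpha>: "\<alpha> \<in> narrow g L j n k" "\<alpha>' = E \<alpha>"
      by blast
    note E = E_narrow[OF \<alpha>(1), folded \<alpha>(2)]
    have "\<alpha>' \<notin> narrow g L (Suc j) (n + 2) (k + 1)"
      using start[OF E(1)] E(2,3) by (auto simp: narrow_def)
    then show "\<alpha>' \<in> narrow g L j (n + 2) (k + 1) - narrow g L (Suc j) (n + 2) (k + 1)"
      using E(1) by blast
  qed
  moreover have "narrow g L (Suc j) (n + 2) (k + 1) \<subseteq> narrow g L j (n + 2) (k + 1)"
    by (auto simp: narrow_def)
  ultimately have "card (narrow g L j (n + 2) (k + 1)) - card (narrow g L (Suc j) (n + 2) (k + 1))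
      = card (narrow g L j n k)"
    using card_image[OF inj] by (simp only: card_Diff_subset finite_narrow flip: card_Diff_subset[OF finite_narrow])
  moreover have "card (narrow g L (Suc j) (n + 2) (k + 1)) \<le> card (narrow g L j (n + 2) (k + 1))"
    using \<open>narrow g L (Suc j) (n + 2) (k + 1) \<subseteq> narrow g L j (n + 2) (k + 1)\<close>
    by (intro card_mono finite_narrow)
  ultimately show ?thesis
    by simp
qed

lemma num_cycles_pos: "0 < n \<Longrightarrow> 0 < num_cycles n \<alpha>"
  by (auto simp: num_cycles_def cycle_sets_def card_gt_0_iff)

text \<open>These are the coefficients that a multiple of \<open>x^2 * y\<close> cannot reach. A
  chord needs two points and is itself a cycle, so no nesting occurs.\<close>

lemma narrow_Suc_small:
  assumes "n < 2 \<or> k = 0"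
  shows "narrow g L (Suc j) n k = narrow g L j n k"
proof -
  have "\<not> nested \<alpha> x" if "\<alpha> \<in> reduced_partitions g n k" for \<alpha> x
  proof
    assume "nested \<alpha> x"
    then have "opens \<alpha> x"
      by (simp add: nested_def)
    then have "n \<ge> 2"
      using that opens_in_interval[of \<alpha> n x] by (auto simp: reduced_partitions_def)
    moreover from this have "k \<noteq> 0"
      using that num_cycles_pos[of n \<alpha>] by (auto simp: reduced_partitions_def)
    ultimately show False
      using assms by simp
  qed
  then show ?thesis
    by (auto simp: narrow_def)
qed

section \<open>Finiteness\<close>

text \<open>
  A cycle of length \<open>m \<ge> 2\<close> contains at most \<open>3(m - 2)\<close> points on which \<open>\<gamma>\<close> is not involutive:
  none if \<open>m = 2\<close>, and \<open>m \<le> 3(m - 2)\<close> otherwise.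
\<close>

lemma card_not_involutive:
  assumes perm: "\<gamma> permutes {1..n}" and no_fix: "\<forall>i\<in>{1..n}. \<gamma> i \<noteq> i"
  shows "card {x \<in> {1..n}. \<gamma> (\<gamma> x) \<noteq> x} + 6 * num_cycles n \<gamma> \<le> 3 * n"
proof -
  define F where "F c = {x \<in> {1..n}. orbit \<gamma> x = c}" for c
  have split: "sum h {1..n} = (\<Sum>c\<in>cycle_sets n \<gamma>. sum h (F c))" for h :: "nat \<Rightarrow> nat"
    unfolding F_def cycle_sets_def by (rule sum.image_gen) simp
  have finite: "finite (F c)" for c
    by (simp add: F_def)
  have image: "\<gamma> x \<in> F c" if "x \<in> F c" for x c
  proof -
    have "permutation \<gamma>"
      using perm permutation_permutes finite_atLeastAtMost by blast
    then have "orbit \<gamma> (\<gamma> x) = c"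
      using that by (simp add: F_def permutation_orbit_step)
    then show ?thesis
      using that by (simp only: F_def mem_Collect_eq permutes_in_image[OF perm] simp_thms)
  qed
  \<comment> \<open>For a cycle of length \<open>m\<close>: if \<open>\<gamma>\<close> is involutive
    on it, the claim is \<open>6 \<le> 3 * m\<close>, which holds as \<open>m \<ge> 2\<close>.
    Otherwise three consecutive points are distinct, so \<open>m \<ge> 3\<close> and
    \<open>m + 6 \<le> 3 * m\<close>.\<close>
  have key: "(\<Sum>x\<in>F c. of_bool (\<gamma> (\<gamma> x) \<noteq> x)) + 6 \<le> (\<Sum>x\<in>F c. 3 :: nat)"
    if "c \<in> cycle_sets n \<gamma>" for c
  proof -
    obtain x where x: "x \<in> F c" "x \<in> {1..n}"
      using \<open>c \<in> cycle_sets n \<gamma>\<close> by (auto simp: F_def cycle_sets_def)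
    have \<gamma>x: "\<gamma> x \<noteq> x"
      using no_fix x(2) by blast
    show ?thesis
    proof (cases "\<exists>y\<in>F c. \<gamma> (\<gamma> y) \<noteq> y")
      case False
      then have "(\<Sum>x\<in>F c. of_bool (\<gamma> (\<gamma> x) \<noteq> x)) = (0 :: nat)"
        by simp
      moreover have "card {x, \<gamma> x} \<le> card (F c)"
        using x image by (intro card_mono finite) auto
      ultimately show ?thesis
        using \<gamma>x by simp
    next
      case True
      then obtain y where y: "y \<in> F c" "\<gamma> (\<gamma> y) \<noteq> y"
        by blast
      have "y \<in> {1..n}" "\<gamma> y \<in> {1..n}"
        using y(1) image[OF y(1)] unfolding F_def by blast+
      then have "\<gamma> y \<noteq> y" "\<gamma> (\<gamma> y) \<noteq> \<gamma> y"
        using no_fix by blast+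
      then have "card {y, \<gamma> y, \<gamma> (\<gamma> y)} = 3"
        using y(2) by (simp add: card_insert_if)
      moreover have "card {y, \<gamma> y, \<gamma> (\<gamma> y)} \<le> card (F c)"
        using y image by (intro card_mono finite) auto
      moreover have "(\<Sum>x\<in>F c. of_bool (\<gamma> (\<gamma> x) \<noteq> x)) \<le> (\<Sum>x\<in>F c. 1 :: nat)"
        by (intro sum_mono) simp
      ultimately show ?thesis
        by simp
    qed
  qed
  have "card {x \<in> {1..n}. \<gamma> (\<gamma> x) \<noteq> x} = (\<Sum>x\<in>{1..n}. of_bool (\<gamma> (\<gamma> x) \<noteq> x))"
    by (simp add: of_bool_def sum.If_cases Int_def)
  moreover have "6 * num_cycles n \<gamma> = (\<Sum>c\<in>cycle_sets n \<gamma>. 6)"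
    by (simp add: num_cycles_def)
  ultimately have "card {x \<in> {1..n}. \<gamma> (\<gamma> x) \<noteq> x} + 6 * num_cycles n \<gamma> =
      (\<Sum>c\<in>cycle_sets n \<gamma>. (\<Sum>x\<in>F c. of_bool (\<gamma> (\<gamma> x) \<noteq> x)) + 6)"
    by (simp only: split sum.distrib)
  also have "\<dots> \<le> (\<Sum>c\<in>cycle_sets n \<gamma>. \<Sum>x\<in>F c. 3)"
    by (rule sum_mono) (rule key)
  also have "\<dots> = (\<Sum>x\<in>{1..n}. 3)"
    by (rule split[symmetric])
  finally show ?thesis
    by simp
qed

lemma num_cycles_le: "num_cycles n \<alpha> \<le> n"
  using card_image_le[of "{1..n}" "orbit \<alpha>"] by (simp add: num_cycles_def cycle_sets_def)

text \<open>Adding the bounds for the two permutations and inserting \<open>n + 1 - 2 * g\<close>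
  for the total number of cycles gives even \<open>12 * g - 6\<close>.\<close>

lemma card_not_involutive_reduced:
  assumes "\<alpha> \<in> reduced_partitions g n k"
  shows "card {x \<in> {1..n}. \<alpha> (\<alpha> x) \<noteq> x} +
    card {x \<in> {1..n}. (inv \<alpha> \<circ> zeta n) ((inv \<alpha> \<circ> zeta n) x) \<noteq> x} \<le> 12 * g"
proof -
  have perm: "\<alpha> permutes {1..n}" and red: "is_reduced n \<alpha>" and genus: "has_genus n \<alpha> g"
    using assms by (simp_all add: reduced_partitions_def)
  have "inv \<alpha> \<circ> zeta n permutes {1..n}"
    by (intro permutes_compose zeta_permutes permutes_inv perm)
  then have "card {x \<in> {1..n}. (inv \<alpha> \<circ> zeta n) ((inv \<alpha> \<circ> zeta n) x) \<noteq> x} +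
      6 * num_cycles n (inv \<alpha> \<circ> zeta n) \<le> 3 * n"
    using red by (intro card_not_involutive) (unfold is_reduced_def, blast+)
  moreover have "card {x \<in> {1..n}. \<alpha> (\<alpha> x) \<noteq> x} + 6 * num_cycles n \<alpha> \<le> 3 * n"
    using red perm by (intro card_not_involutive) (unfold is_reduced_def, blast+)
  ultimately show ?thesis
    using genus unfolding has_genus_def by linarith
qed

text \<open>An outermost chord \<open>(p q)\<close> cannot be continued outwards: either
  \<open>p = 1\<close>, or \<open>q = n\<close>, or \<open>\<alpha>\<close> fails to be involutive
  at \<open>p - 1\<close>, or \<open>\<beta>\<close> fails to be so at \<open>q\<close>. The first
  two cases account for at most 2 ribbons, the others for at most \<open>12 * g\<close>.\<close>

lemma card_ribbons_le:
  assumes "\<alpha> \<in> reduced_partitions g n k"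
  shows "card (ribbons \<alpha>) \<le> 12 * g + 2"
proof -
  define \<beta> where "\<beta> = inv \<alpha> \<circ> zeta n"
  define A where "A = {x \<in> {1..n}. \<alpha> (\<alpha> x) \<noteq> x}"
  define B where "B = {x \<in> {1..n}. \<beta> (\<beta> x) \<noteq> x}"
  have perm: "\<alpha> permutes {1..n}"
    using assms by (simp add: reduced_partitions_def)
  have "ribbons \<alpha> \<subseteq> {1, inv \<alpha> n} \<union> (Suc ` A \<union> inv \<alpha> ` B)"
  proof
    fix p assume p: "p \<in> ribbons \<alpha>"
    then have op: "opens \<alpha> p"
      by (simp add: ribbons_def)
    define q where "q = \<alpha> p"
    have q: "\<alpha> q = p" "p < q" "1 \<le> p" "q \<le> n" "inv \<alpha> q = p" "inv \<alpha> p = q"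
      using op opens_in_interval[OF perm op] permutes_inv_eq[OF perm]
      by (auto simp: opens_def q_def)
    show "p \<in> {1, inv \<alpha> n} \<union> (Suc ` A \<union> inv \<alpha> ` B)"
    proof (rule ccontr)
      assume contra: "\<not> ?thesis"
      then have "p \<noteq> 1" "q \<noteq> n"
        using q by auto
      then obtain x where x: "p = Suc x" "1 \<le> x" "q < n"
        using q by (cases p) auto
      have "x \<notin> A" "q \<notin> B"
        using contra x q by (auto simp: image_iff)
      then have "\<alpha> (\<alpha> x) = x" "\<beta> (\<beta> q) = q"
        using x q by (auto simp: A_def B_def)
      \<comment> \<open>As \<open>\<beta>\<close> sends \<open>p - 1\<close> to \<open>q\<close> and
        is involutive at \<open>q\<close>, it sends \<open>q\<close> back to \<open>p - 1\<close>;
        this makes \<open>(p-1 q+1)\<close> a chord.\<close>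
      moreover have "\<beta> x = q"
        using x q by (simp add: \<beta>_def zeta_apply)
      moreover have "\<beta> q = inv \<alpha> (Suc q)"
        using x q by (simp add: \<beta>_def zeta_apply)
      moreover have "inj \<beta>"
        unfolding \<beta>_def
        by (rule permutes_inj[OF permutes_compose[OF zeta_permutes permutes_inv[OF perm]]])
      ultimately have "inv \<alpha> (Suc q) = x"
        by (metis injD)
      then have "\<alpha> x = Suc q"
        using permutes_inv_eq[OF perm] by simp
      then have "nested \<alpha> x"
        using \<open>\<alpha> (\<alpha> x) = x\<close> op x q by (simp add: nested_def opens_def q_def)
      then show False
        using p x by (simp add: ribbons_def)
    qed
  qed
  moreover have fin: "finite A" "finite B"
    by (simp_all add: A_def B_def)
  ultimately have "card (ribbons \<alpha>) \<le> card ({1, inv \<alpha> n} \<union> (Suc ` A \<union> inv \<alpha> ` B))"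
    by (intro card_mono) auto
  also have "\<dots> \<le> card {1, inv \<alpha> n} + (card (Suc ` A) + card (inv \<alpha> ` B))"
    by (intro order_trans[OF card_Un_le] add_left_mono card_Un_le)
  also have "\<dots> \<le> 2 + (card A + card B)"
    using fin by (intro add_mono card_image_le) (simp_all add: card_insert_if)
  also have "\<dots> \<le> 12 * g + 2"
    using card_not_involutive_reduced[OF assms] unfolding A_def B_def \<beta>_def by simp
  finally show ?thesis .
qed

text \<open>When all \<open>L\<close> ribbons have width 1 there are only \<open>L\<close> chords.
  They cover at most \<open>2 * L\<close> points, and \<open>\<alpha>\<close> is not involutive at
  any other point.\<close>

lemma narrow_bound:
  assumes "\<alpha> \<in> narrow g L L n k"
  shows "n \<le> 12 * g + 2 * L"
proof -
  define A where "A = {x \<in> {1..n}. \<alpha> (\<alpha> x) \<noteq> x}"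
  have perm: "\<alpha> permutes {1..n}" and red: "\<alpha> \<in> reduced_partitions g n k"
    and no_fix: "\<forall>i\<in>{1..n}. \<alpha> i \<noteq> i"
    using assms by (auto simp: narrow_def reduced_partitions_def is_reduced_def)
  have L: "card (ribbons \<alpha>) = L"
    using assms by (simp add: narrow_def)
  have fin: "finite (ribbons \<alpha>)"
    by (rule finite_ribbons[OF perm])
  have not_nested: "\<not> nested \<alpha> x" if "x \<in> ribbons \<alpha>" for x
  proof -
    have "card (ribbons \<alpha> \<inter> {..<x}) < card (ribbons \<alpha>)"
      using that fin by (intro psubset_card_mono) auto
    then show ?thesis
      using assms that by (simp add: narrow_def)
  qed
  \<comment> \<open>A chord that is not outermost has an outer neighbour, which is a ribbon by
    induction; but no ribbon start is nested.\<close>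
  have opens_ribbons: "x \<in> ribbons \<alpha>" if "opens \<alpha> x" for x
    using that
  proof (induction x)
    case 0
    then show ?case
      by (simp add: ribbons_def)
  next
    case (Suc x)
    then have "\<not> nested \<alpha> x"
      using not_nested by (auto simp: nested_def)
    then show ?case
      using Suc.prems by (simp add: ribbons_def)
  qed
  have "{1..n} \<subseteq> A \<union> (ribbons \<alpha> \<union> \<alpha> ` ribbons \<alpha>)"
  proof
    fix x assume x: "x \<in> {1..n}"
    show "x \<in> A \<union> (ribbons \<alpha> \<union> \<alpha> ` ribbons \<alpha>)"
    proof (cases "x \<in> A")
      case False
      then have inv: "\<alpha> (\<alpha> x) = x"
        using x by (simp add: A_def)
      have "opens \<alpha> x \<or> opens \<alpha> (\<alpha> x)"
        using no_fix x inv unfolding opens_def by (metis linorder_neqE_nat)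
      then show ?thesis
        using opens_ribbons inv by (metis UnI1 UnI2 image_eqI)
    qed simp
  qed
  then have "card {1..n} \<le> card (A \<union> (ribbons \<alpha> \<union> \<alpha> ` ribbons \<alpha>))"
    using fin by (intro card_mono) (auto simp: A_def)
  also have "\<dots> \<le> card A + (card (ribbons \<alpha>) + card (\<alpha> ` ribbons \<alpha>))"
    by (intro order_trans[OF card_Un_le] add_left_mono card_Un_le)
  also have "\<dots> \<le> 12 * g + (L + L)"
    using card_not_involutive_reduced[OF red] card_image_le[OF fin, of \<alpha>]
    unfolding A_def L by simp
  finally show ?thesis
    by simp
qed

section \<open>Generating functions\<close>

abbreviation (input) denom :: "rat fps fps" where
  "denom \<equiv> 1 - var_x ^ 2 * var_y"

text \<open>The polynomials in both variables, described by one common bound for the two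
  exponents.\<close>

definition bounded_support :: "rat fps fps \<Rightarrow> bool" where
  "bounded_support F \<longleftrightarrow> (\<exists>B. \<forall>n k. B < n \<or> B < k \<longrightarrow> fps_nth (fps_nth F n) k = 0)"

text \<open>The guard excludes the exponents at which \<open>n - 2\<close> or \<open>k - 1\<close>
  would be truncated.\<close>

lemma mult_denom_nth:
  "fps_nth (fps_nth (F * denom) n) k = fps_nth (fps_nth F n) k -
     (if 2 \<le> n \<and> 1 \<le> k then fps_nth (fps_nth F (n - 2)) (k - 1) else 0)"
proof -
  have "F * denom = F - fps_X ^ 2 * (F * fps_const fps_X)"
    by (simp add: var_x_def var_y_def algebra_simps)
  then show ?thesis
    by (simp add: fps_X_power_mult_nth)
qed

lemma bounded_support_mult_denom_power:
  assumes "bounded_support F"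
  shows "bounded_support (F * denom ^ m)"
proof (induction m)
  case (Suc m)
  then obtain B where "\<forall>n k. B < n \<or> B < k \<longrightarrow> fps_nth (fps_nth (F * denom ^ m) n) k = 0"
    by (auto simp: bounded_support_def)
  \<comment> \<open>Each factor raises the exponents of \<open>x\<close> and \<open>y\<close> by at
    most 2 and 1.\<close>
  then have "\<forall>n k. B + 2 < n \<or> B + 2 < k \<longrightarrow> fps_nth (fps_nth (F * denom ^ m * denom) n) k = 0"
    unfolding mult_denom_nth by auto
  then show ?case
    unfolding bounded_support_def power_Suc2 mult.assoc[symmetric] by blast
qed (use assms in simp)

lemma bounded_support_sum:
  assumes "finite I" "\<And>i. i \<in> I \<Longrightarrow> bounded_support (F i)"
  shows "bounded_support (sum F I)"
  using assms
proof (induction I)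
  case empty
  then show ?case
    by (simp add: bounded_support_def)
next
  case (insert i I)
  then obtain B C where "\<forall>n k. B < n \<or> B < k \<longrightarrow> fps_nth (fps_nth (F i) n) k = 0"
    "\<forall>n k. C < n \<or> C < k \<longrightarrow> fps_nth (fps_nth (sum F I) n) k = 0"
    unfolding bounded_support_def by blast
  then have "\<forall>n k. max B C < n \<or> max B C < k \<longrightarrow> fps_nth (fps_nth (F i + sum F I) n) k = 0"
    by auto
  then show ?case
    unfolding bounded_support_def sum.insert[OF insert.hyps] by blast
qed

lemma bounded_support_is_poly:
  assumes "bounded_support F"
  shows "\<exists>A. F = fps2_of_poly2 A"
proof -
  obtain B where B: "fps_nth (fps_nth F n) k = 0" if "B < n \<or> B < k" for n k
    using assms by (auto simp: bounded_support_def)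
  \<comment> \<open>Both coefficient lists are cut off after \<open>B\<close>; beyond that, the
    default 0 agrees with the series.\<close>
  define A where "A = Poly (map (\<lambda>n. Poly (map (fps_nth (fps_nth F n)) [0..<Suc B])) [0..<Suc B])"
  have "coeff (coeff A n) k = fps_nth (fps_nth F n) k" for n k
    using B by (auto simp: A_def nth_default_def simp del: upt_Suc)
  then have "F = fps2_of_poly2 A"
    by (intro fps_ext) (simp add: fps2_of_poly2_def coeff_map_poly)
  then show ?thesis
    by blast
qed

definition narrow_gf :: "nat \<Rightarrow> nat \<Rightarrow> nat \<Rightarrow> rat fps fps" where
  "narrow_gf g L j = Abs_fps (\<lambda>n. Abs_fps (\<lambda>k. of_nat (card (narrow g L j n k))))"

lemma narrow_gf_mult_denom:
  assumes "j < L"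
  shows "narrow_gf g L j * denom = narrow_gf g L (Suc j)"
proof (intro fps_ext)
  fix n k
  show "fps_nth (fps_nth (narrow_gf g L j * denom) n) k = fps_nth (fps_nth (narrow_gf g L (Suc j)) n) k"
  proof (cases "2 \<le> n \<and> 1 \<le> k")
    case True
    then have "n - 2 + 2 = n" "k - 1 + 1 = k"
      by linarith+
    then show ?thesis
      using True card_narrow_Suc[OF assms, of g "n - 2" "k - 1"]
      unfolding mult_denom_nth by (simp add: narrow_gf_def)
  next
    case False
    then show ?thesis
      unfolding mult_denom_nth using narrow_Suc_small[of n k] by (auto simp: narrow_gf_def not_le)
  qed
qed

lemma narrow_gf_mult_denom_power: "j \<le> L \<Longrightarrow> narrow_gf g L 0 * denom ^ j = narrow_gf g L j"
proof (induction j)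
  case (Suc j)
  then show ?case
    using narrow_gf_mult_denom[of j L g] by (simp only: power_Suc2 mult.assoc[symmetric])
qed simp

lemma bounded_support_narrow_gf: "bounded_support (narrow_gf g L L)"
proof -
  have "narrow g L L n k = {}" if "12 * g + 2 * L < n \<or> 12 * g + 2 * L < k" for n k
  proof (rule ccontr)
    assume "narrow g L L n k \<noteq> {}"
    then obtain \<alpha> where \<alpha>: "\<alpha> \<in> narrow g L L n k"
      by blast
    then have "k \<le> n"
      using num_cycles_le by (auto simp: narrow_def reduced_partitions_def)
    then show False
      using narrow_bound[OF \<alpha>] that by simp
  qed
  then show ?thesis
    unfolding bounded_support_def narrow_gf_def
    by (intro exI[of _ "12 * g + 2 * L"]) simp
qed

text \<open>Reduced partitions are classified by their number of ribbons; with \<open>j = 0\<close>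
  no width is restricted.\<close>

lemma num_reduced_eq_sum:
  "num_reduced g n k = (\<Sum>L\<le>12 * g + 2. card (narrow g L 0 n k))"
proof -
  have "reduced_partitions g n k = (\<Union>L\<le>12 * g + 2. narrow g L 0 n k)"
    using card_ribbons_le by (auto simp: narrow_def)
  then show ?thesis
    unfolding num_reduced_def
    by (simp only:) (rule card_UN_disjoint, auto simp: finite_narrow, auto simp: narrow_def)
qed

lemma num_reduced_zero:
  assumes "n = 0 \<or> k = 0"
  shows "num_reduced g n k = 0"
proof -
  have "reduced_partitions g n k = {}"
  proof (rule ccontr)
    assume "reduced_partitions g n k \<noteq> {}"
    then obtain \<alpha> where \<alpha>: "has_genus n \<alpha> g" "num_cycles n \<alpha> = k"
      by (auto simp: reduced_partitions_def)
    then have "n = 0"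
      using num_cycles_pos[of n \<alpha>] assms by linarith
    \<comment> \<open>For \<open>n = 0\<close> both cycle counts vanish, and the genus equation
      fails by parity.\<close>
    then have "1 - 2 * int g = 0"
      using \<alpha>(1) by (simp add: has_genus_def num_cycles_def cycle_sets_def)
    then show False
      by presburger
  qed
  then show ?thesis
    by (simp add: num_reduced_def)
qed

lemma reduced_gf_eq_sum: "reduced_gf g = (\<Sum>L\<le>12 * g + 2. narrow_gf g L 0)"
proof (intro fps_ext)
  fix n k
  have "fps_nth (fps_nth (reduced_gf g) n) k = of_nat (num_reduced g n k)"
    using num_reduced_zero[of n k g] by (auto simp: reduced_gf_def not_le Suc_le_eq)
  then show "fps_nth (fps_nth (reduced_gf g) n) k = fps_nth (fps_nth (\<Sum>L\<le>12 * g + 2. narrow_gf g L 0) n) k"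
    by (simp only: num_reduced_eq_sum fps_sum_nth) (simp add: narrow_gf_def)
qed

theorem corollary6p9:
  fixes g :: nat
  shows "\<exists>(A :: rat poly poly) (N :: nat).
           reduced_gf g = fps2_of_poly2 A / (1 - var_x ^ 2 * var_y) ^ N"
proof -
  \<comment> \<open>\<open>N\<close> bounds the number of ribbons, so one exponent serves every
    \<open>L\<close>: the first \<open>L\<close> factors already produce a polynomial, and the other
    \<open>N - L\<close> preserve this.\<close>
  define N where "N = 12 * g + 2"
  have "bounded_support (narrow_gf g L 0 * denom ^ N)" if "L \<le> N" for L
  proof -
    have "denom ^ N = denom ^ L * denom ^ (N - L)"
      using that by (simp flip: power_add)
    then have "narrow_gf g L 0 * denom ^ N = narrow_gf g L L * denom ^ (N - L)"
      by (simp only: mult.assoc[symmetric] narrow_gf_mult_denom_power[OF order_refl])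
    then show ?thesis
      by (simp only: bounded_support_mult_denom_power[OF bounded_support_narrow_gf])
  qed
  then have "bounded_support (reduced_gf g * denom ^ N)"
    unfolding reduced_gf_eq_sum N_def[symmetric] sum_distrib_right
    by (intro bounded_support_sum) auto
  then obtain A where "reduced_gf g * denom ^ N = fps2_of_poly2 A"
    using bounded_support_is_poly by blast
  then have "reduced_gf g = fps2_of_poly2 A / denom ^ N"
    by (simp only: divide_power_denominator_iff)
  then show ?thesis
    by blast
qed

end
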